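(* Let $m,n\in\mathbb{N}$ and let $\mathcal{A}\in\mathbb{S}_{m,n}$. Then $\mathcal{A}\in GDD^+_{m,n}$ if and only if there exist $r\in\mathbb{N}$ and tensors $\mathcal{B}_1,\dots,\mathcal{B}_r\in \mathbb{D}_{m,n}\cap GDD^+_{m,n}$ such that $\mathcal{A}=\sum_{i=1}^{r}\mathcal{B}_i$.
   Context: $\mathbb{S}_{m,n}$ is the set of real symmetric tensors $\mathcal{A}=(a_{i_1\dots i_m})$ of order $m$ and dimension $n$ (indices in $[n]=\{1,\dots,n\}$, entries invariant under permutations of the indices). The diagonal elements of $\mathcal{A}$ are the entries $a_{ii\dots i}$. A tensor $\mathcal{A}$ is diagonally dominant (DD) if $|a_{ii\dots i}|\ge\sum_{(i_2,\dots,i_m)\ne(i,\dots,i)}|a_{ii_2\dots i_m}|$ for all $i\in[n]$. It is generalized diagonally dominant (GDD) if there is a diagonal matrix $D$ with positive diagonal entries $d_1,\dots,d_n$ such that the tensor with entries $a_{i_1\dots i_m}d_{i_1}^{1-m}d_{i_2}\cdots d_{i_m}$ is DD. $GDD^+_{m,n}$ is the set of GDD tensors in $\mathbb{S}_{m,n}$ with nonnegative diagonal elements. $\mathscr{D}_n^m$ is the set of $(i_1,\dots,i_m)$ with $1\le i_1\le\cdots\le i_m\le n$ that are not all equal. For $(i_1,\dots,i_m)\in\mathscr{D}_n^m$, $\mathscr{P}_{i_1\dots i_m}$ is the set of all permutations of $(i_1,\dots,i_m)$ and $\mathscr{Q}_{i_1\dots i_m}=\{(p,p,\dots,p): p\in\{i_1,\dots,i_m\}\}$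 ($m$-tuples). $\mathbb{D}^{i_1\dots i_m}_{m,n}$ is the set of $(a_{j_1\dots j_m})\in\mathbb{S}_{m,n}$ with $a_{j_1\dots j_m}=0$ whenever $(j_1,\dots,j_m)\notin\mathscr{P}_{i_1\dots i_m}\cup\mathscr{Q}_{i_1\dots i_m}$, and $\mathbb{D}_{m,n}=\bigcup_{(i_1,\dots,i_m)\in\mathscr{D}_n^m}\mathbb{D}^{i_1\dots i_m}_{m,n}$.
   Formalization: The theorem is stated for m,n ≥ 2: if m = 1 or n = 1 there are no non-constant index tuples, so D_{m,n} is empty and the claim fails, e.g. for the tensor with all diagonal entries 1, which lies in GDD^+_{m,n}. *)

theory Defs
  imports Complex_Main "HOL-Library.Multiset"
begin

text \<open>
  A tensor of order \<open>m\<close> and dimension \<open>n\<close> is a function \<open>nat list \<Rightarrow> real\<close> on the index tuples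
  \<open>index_set m n\<close>. The members of \<open>sym_tensors m n\<close> vanish off the index tuples, so that
  equality of functions is equality of tensors.
\<close>

definition index_set :: "nat \<Rightarrow> nat \<Rightarrow> nat list set" where
  "index_set m n = {is. length is = m \<and> set is \<subseteq> {1..n}}"

definition sym_tensors :: "nat \<Rightarrow> nat \<Rightarrow> (nat list \<Rightarrow> real) set" where
  "sym_tensors m n = {A. (\<forall>is. is \<notin> index_set m n \<longrightarrow> A is = 0) \<and>
     (\<forall>is\<in>index_set m n. \<forall>js\<in>index_set m n. mset is = mset js \<longrightarrow> A is = A js)}"

definition diag_dominant :: "nat \<Rightarrow> nat \<Rightarrow> (nat list \<Rightarrow> real) \<Rightarrow> bool" where
  "diag_dominant m n A \<longleftrightarrow> (\<forall>i\<in>{1..n}.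
     \<bar>A (replicate m i)\<bar> \<ge> (\<Sum>js\<in>index_set (m - 1) n - {replicate (m - 1) i}. \<bar>A (i # js)\<bar>))"

definition diag_scale :: "nat \<Rightarrow> (nat \<Rightarrow> real) \<Rightarrow> (nat list \<Rightarrow> real) \<Rightarrow> nat list \<Rightarrow> real" where
  "diag_scale m d A is = A is * d (hd is) powi (1 - int m) * prod_list (map d (tl is))"

definition gen_diag_dominant :: "nat \<Rightarrow> nat \<Rightarrow> (nat list \<Rightarrow> real) \<Rightarrow> bool" where
  "gen_diag_dominant m n A \<longleftrightarrow>
     (\<exists>d. (\<forall>i\<in>{1..n}. d i > 0) \<and> diag_dominant m n (diag_scale m d A))"

definition GDD_plus :: "nat \<Rightarrow> nat \<Rightarrow> (nat list \<Rightarrow> real) set" where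
  "GDD_plus m n = {A \<in> sym_tensors m n.
     gen_diag_dominant m n A \<and> (\<forall>i\<in>{1..n}. A (replicate m i) \<ge> 0)}"

definition offdiag_indices :: "nat \<Rightarrow> nat \<Rightarrow> nat list set" where
  "offdiag_indices m n = {is \<in> index_set m n. sorted is \<and> \<not> (\<exists>p. is = replicate m p)}"

definition perm_tuples :: "nat list \<Rightarrow> nat list set" where
  "perm_tuples is = {js. mset js = mset is}"

definition diag_tuples :: "nat list \<Rightarrow> nat list set" where
  "diag_tuples is = {replicate (length is) p |p. p \<in> set is}"

definition simple_tensors_at :: "nat \<Rightarrow> nat \<Rightarrow> nat list \<Rightarrow> (nat list \<Rightarrow> real) set" where
  "simple_tensors_at m n is = {A \<in> sym_tensors m n.
     \<forall>js\<in>index_set m n. js \<notin> perm_tuples is \<union> diag_tuples is \<longrightarrow> A js = 0}"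

definition simple_tensors :: "nat \<Rightarrow> nat \<Rightarrow> (nat list \<Rightarrow> real) set" where
  "simple_tensors m n = (\<Union>is\<in>offdiag_indices m n. simple_tensors_at m n is)"

end

theory Submission
  imports Defs "HOL-Complex_Analysis.Great_Picard"
begin

text \<open>
  If \<open>A\<close> is scaled to a diagonally dominant tensor by \<open>d\<close>, then its off-diagonal entries can be
  distributed over their permutation classes, and each class can be given exactly the diagonal
  entries that it needs to be dominated under the same \<open>d\<close>. The classes partition every row, so the
  diagonal entries of \<open>A\<close> pay for all of them, and what is left over is a nonnegative diagonal tensor
  (lemma \<open>class_parts_plus_slack\<close>).

  Conversely, generalized diagonally dominant symmetric tensors with nonnegative diagonal are closed
  under sums, although the summands have different scaling vectors. The reason is a
  characterization without scaling vectors (lemma \<open>GDD_plus_iff_comparison_nonneg\<close>): such a tensor is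
  generalized diagonally dominant if and only if
  \<open>(\<Sum>is. \<bar>A is\<bar> * x\<^sub>i\<^sub>s) \<le> (\<Sum>i. A (i, \<dots>, i) * x\<^sub>i ^ m)\<close> for all \<open>x \<ge> 0\<close>, where the first sum ranges over
  the off-diagonal tuples \<open>is\<close> and \<open>x\<^sub>i\<^sub>s\<close> denotes the product of the coordinates of \<open>x\<close> along \<open>is\<close>. By
  the triangle inequality this condition passes to sums.

  One half of the characterization is the inequality between geometric and arithmetic mean, averaged
  over the positions of a tuple. The other half is of Perron-Frobenius type. For a diagonal enlarged
  by \<open>e > 0\<close>, the form controls the size of all nonnegative subsolutions of a monotone system of
  equations, and the supremum of the subsolutions is a positive scaling vector. As \<open>e\<close> tends to \<open>0\<close>,
  the ratios of the coordinates stay bounded within each connected component of the indices coupled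
  by nonzero entries, so after normalizing every component a subsequence converges to a positive
  scaling vector for \<open>A\<close> itself.
\<close>

section \<open>Monomials along index tuples\<close>

definition monomial :: "(nat \<Rightarrow> real) \<Rightarrow> nat list \<Rightarrow> real" where
  "monomial x is = prod_list (map x is)"

lemma monomial_simps [simp]:
  "monomial x [] = 1" "monomial x (i # is) = x i * monomial x is"
  "monomial x (replicate k i) = x i ^ k"
  by (simp_all add: monomial_def map_replicate)

lemma monomial_mult: "monomial (\<lambda>i. x i * y i) is = monomial x is * monomial y is"
  by (induction "is") auto

lemma monomial_nonneg: "(\<And>i. i \<in> set is \<Longrightarrow> 0 \<le> x i) \<Longrightarrow> 0 \<le> monomial x is"
  by (induction "is") auto

lemma monomial_mono:
  "(\<And>i. i \<in> set is \<Longrightarrow> 0 \<le> x i \<and> x i \<le> y i) \<Longrightarrow> monomial x is \<le> monomial y is"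
  by (induction "is") (auto intro!: mult_mono monomial_nonneg intro: order_trans)

lemma monomial_cong: "(\<And>i. i \<in> set is \<Longrightarrow> x i = y i) \<Longrightarrow> monomial x is = monomial y is"
  by (induction "is") auto

lemma monomial_cong_mset: "mset is = mset js \<Longrightarrow> monomial x is = monomial x js"
  unfolding monomial_def by (metis mset_map prod_mset_prod_list)

lemma monomial_conv_prod: "monomial x is = (\<Prod>j<length is. x (is ! j))"
  unfolding monomial_def by (simp add: prod.list_conv_set_nth atLeast0LessThan)

section \<open>Index tuples and symmetric tensors\<close>

definition off_tuples :: "nat \<Rightarrow> nat \<Rightarrow> nat list set" where
  "off_tuples m n = {is \<in> index_set m n. \<not> (\<exists>p. is = replicate m p)}"

lemma finite_index_set [simp]: "finite (index_set m n)"
  using finite_lists_length_eq[of "{1..n}" m]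
  by (simp add: index_set_def conj_commute)

lemma finite_off_tuples [simp]: "finite (off_tuples m n)"
  by (simp add: off_tuples_def)

lemma Cons_in_index_set:
  "m \<ge> 1 \<Longrightarrow> i # js \<in> index_set m n \<longleftrightarrow> i \<in> {1..n} \<and> js \<in> index_set (m - 1) n"
  by (auto simp: index_set_def)

lemma replicate_in_index_set: "i \<in> {1..n} \<Longrightarrow> replicate m i \<in> index_set m n"
  by (auto simp: index_set_def)

lemma index_set_cong_mset: "mset is = mset js \<Longrightarrow> is \<in> index_set m n \<longleftrightarrow> js \<in> index_set m n"
  unfolding index_set_def by (metis (mono_tags, lifting) mem_Collect_eq mset_eq_length mset_eq_setD)

lemma eq_replicate_cong_mset: "mset is = mset js \<Longrightarrow> is = replicate m p \<longleftrightarrow> js = replicate m p"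
  by (metis mset_eq_length mset_eq_setD replicate_eqI length_replicate in_set_replicate)

lemma off_tuples_cong_mset: "mset is = mset js \<Longrightarrow> is \<in> off_tuples m n \<longleftrightarrow> js \<in> off_tuples m n"
  unfolding off_tuples_def
  using index_set_cong_mset[of "is" js m n] eq_replicate_cong_mset[of "is" js m] by simp

lemma sym_tensors_cong_mset: "A \<in> sym_tensors m n \<Longrightarrow> mset is = mset js \<Longrightarrow> A is = A js"
  using index_set_cong_mset[of "is" js m n] by (auto simp: sym_tensors_def)

lemma sym_tensorsI:
  assumes "\<And>is. is \<notin> index_set m n \<Longrightarrow> A is = 0" "\<And>is js. mset is = mset js \<Longrightarrow> A is = A js"
  shows "A \<in> sym_tensors m n"
  unfolding sym_tensors_def mem_Collect_eq using assms by (intro conjI ballI allI impI)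

lemma Cons_in_off_tuples:
  assumes "m \<ge> 1"
  shows "i # js \<in> off_tuples m n \<longleftrightarrow>
    i \<in> {1..n} \<and> js \<in> index_set (m - 1) n - {replicate (m - 1) i}"
proof -
  have "(i # js = replicate m p) \<longleftrightarrow> p = i \<and> js = replicate (m - 1) i" for p
    using assms by (cases m) auto
  then show ?thesis
    using Cons_in_index_set[OF assms] by (auto simp: off_tuples_def)
qed

lemma sum_off_tuples_by_head:
  assumes "m \<ge> 1"
  shows "(\<Sum>is\<in>off_tuples m n. f is) =
    (\<Sum>i\<in>{1..n}. \<Sum>js\<in>index_set (m - 1) n - {replicate (m - 1) i}. f (i # js))"
proof -
  have "is \<in> off_tuples m n \<Longrightarrow> \<exists>i js. is = i # js" for "is"
    using assms by (cases "is") (auto simp: off_tuples_def index_set_def)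
  then have "off_tuples m n =
      (\<lambda>(i, js). i # js) ` (SIGMA i:{1..n}. index_set (m - 1) n - {replicate (m - 1) i})"
    using Cons_in_off_tuples[OF assms] by (fastforce simp: image_iff)
  moreover have "inj_on (\<lambda>(i, js). i # js) B" for B :: "(nat \<times> nat list) set"
    by (auto simp: inj_on_def)
  ultimately show ?thesis
    by (simp add: sum.reindex sum.Sigma o_def case_prod_unfold)
qed

section \<open>Row sums and the comparison form\<close>

definition off_row :: "nat \<Rightarrow> nat \<Rightarrow> (nat list \<Rightarrow> real) \<Rightarrow> (nat \<Rightarrow> real) \<Rightarrow> nat \<Rightarrow> real" where
  "off_row m n A x i =
     (\<Sum>js\<in>index_set (m - 1) n - {replicate (m - 1) i}. \<bar>A (i # js)\<bar> * monomial x js)"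

text \<open>
  The form attached to the comparison tensor, which keeps the diagonal entries and replaces every
  other entry by minus its absolute value, is nonnegative on the nonnegative orthant. The left-hand
  side collects the off-diagonal part of that form, the right-hand side the diagonal part.
\<close>

definition comparison_nonneg :: "nat \<Rightarrow> nat \<Rightarrow> (nat list \<Rightarrow> real) \<Rightarrow> bool" where
  "comparison_nonneg m n A \<longleftrightarrow> (\<forall>x. (\<forall>i. 0 \<le> x i) \<longrightarrow>
     (\<Sum>is\<in>off_tuples m n. \<bar>A is\<bar> * monomial x is) \<le> (\<Sum>i\<in>{1..n}. A (replicate m i) * x i ^ m))"

lemma off_row_nonneg: "(\<And>p. p \<in> {1..n} \<Longrightarrow> 0 \<le> x p) \<Longrightarrow> 0 \<le> off_row m n A x i"
  by (auto simp: off_row_def index_set_def intro!: sum_nonneg mult_nonneg_nonneg monomial_nonneg)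

lemma off_row_mono:
  "(\<And>p. p \<in> {1..n} \<Longrightarrow> 0 \<le> x p \<and> x p \<le> y p) \<Longrightarrow> off_row m n A x i \<le> off_row m n A y i"
  by (auto simp: off_row_def index_set_def intro!: sum_mono mult_left_mono monomial_mono)

lemma comparison_nonneg_rows:
  assumes "m \<ge> 1" "comparison_nonneg m n A" "\<And>i. 0 \<le> x i"
  shows "(\<Sum>i\<in>{1..n}. x i * off_row m n A x i) \<le> (\<Sum>i\<in>{1..n}. A (replicate m i) * x i ^ m)"
proof -
  have "(\<Sum>i\<in>{1..n}. x i * off_row m n A x i) = (\<Sum>is\<in>off_tuples m n. \<bar>A is\<bar> * monomial x is)"
    unfolding sum_off_tuples_by_head[OF assms(1)]
    by (simp add: off_row_def sum_distrib_left mult_ac)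
  then show ?thesis using assms(2,3) by (simp add: comparison_nonneg_def)
qed

text \<open>
  Multiplying the dominance inequality of row \<open>i\<close> by \<open>d i ^ (m - 1)\<close> clears the negative power; the
  scaling leaves the diagonal entries unchanged.
\<close>

lemma gen_diag_dominant_iff_off_row:
  assumes "m \<ge> 1" and nonneg: "\<And>i. i \<in> {1..n} \<Longrightarrow> A (replicate m i) \<ge> 0"
  shows "gen_diag_dominant m n A \<longleftrightarrow>
    (\<exists>d. \<forall>i\<in>{1..n}. d i > 0 \<and> off_row m n A d i \<le> A (replicate m i) * d i ^ (m - 1))"
proof -
  have "\<bar>diag_scale m d A (replicate m i)\<bar> \<ge>
        (\<Sum>js\<in>index_set (m - 1) n - {replicate (m - 1) i}. \<bar>diag_scale m d A (i # js)\<bar>)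
      \<longleftrightarrow> off_row m n A d i \<le> A (replicate m i) * d i ^ (m - 1)"
    if d: "\<forall>i\<in>{1..n}. d i > 0" and i: "i \<in> {1..n}" for d i
  proof -
    have di: "d i > 0" using d i by simp
    have pw: "d i powi (1 - int m) = inverse (d i ^ (m - 1))"
      using assms(1) by (simp add: power_int_def nat_diff_distrib power_inverse)
    obtain k where k: "m = Suc k" using assms(1) by (cases m) auto
    have 1: "\<bar>diag_scale m d A (replicate m i)\<bar> = A (replicate m i)"
      using di nonneg[OF i] pw by (simp add: diag_scale_def k map_replicate)
    have "\<bar>diag_scale m d A (i # js)\<bar> = inverse (d i ^ (m - 1)) * (\<bar>A (i # js)\<bar> * monomial d js)"
      if "js \<in> index_set (m - 1) n" for js
    proof -
      have "monomial d js \<ge> 0" using that d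
        by (intro monomial_nonneg) (auto simp: index_set_def intro: less_imp_le)
      then show ?thesis
        using di by (simp add: diag_scale_def pw abs_mult flip: monomial_def)
    qed
    then have 2: "(\<Sum>js\<in>index_set (m - 1) n - {replicate (m - 1) i}. \<bar>diag_scale m d A (i # js)\<bar>)
        = inverse (d i ^ (m - 1)) * off_row m n A d i"
      by (simp add: off_row_def sum_distrib_left)
    show ?thesis unfolding 1 2 using di by (simp add: field_simps)
  qed
  then show ?thesis
    unfolding gen_diag_dominant_def diag_dominant_def by meson
qed

section \<open>Generalized diagonal dominance makes the comparison form nonnegative\<close>

text \<open>
  This is the inequality between the geometric and the arithmetic mean of the numbers
  \<open>z (is ! j) ^ m\<close> with \<open>m = length is\<close>, in the form without roots.
\<close>

lemma monomial_le_sum_powers: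
  assumes "\<And>i. i \<in> set is \<Longrightarrow> 0 \<le> z i"
  shows "length is * monomial z is \<le> (\<Sum>j<length is. z (is ! j) ^ length is)"
proof (cases "is = []")
  case False
  define m where "m = length is"
  have m: "m > 0" using False by (simp add: m_def)
  have nn: "0 \<le> z (is ! j)" if "j < m" for j using that assms by (simp add: m_def)
  have "(\<Prod>j<m. z (is ! j) ^ m) powr (1 / m) = (monomial z is ^ m) powr (1 / m)"
    by (simp add: monomial_conv_prod m_def prod_power_distrib)
  also have "\<dots> = monomial z is"
    using m monomial_nonneg[of "is" z] assms
    by (cases "monomial z is = 0") (auto simp: powr_powr simp flip: powr_realpow)
  finally have "monomial z is \<le> (\<Sum>j<m. z (is ! j) ^ m / m)"
    using arith_geom_mean[of "{..<m}" "\<lambda>j. z (is ! j) ^ m"] m nn by (auto simp: lessThan_empty_iff)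
  then show ?thesis using m by (simp add: m_def field_simps flip: sum_divide_distrib)
qed auto

text \<open>
  Exchanging the positions \<open>0\<close> and \<open>j\<close> permutes the off-diagonal tuples and leaves a symmetric
  weight unchanged, so all positions contribute equally. This is the step where the symmetry of
  the tensor turns a bound on single rows into a bound on the form.
\<close>

lemma sum_off_tuples_position:
  assumes f: "\<And>is js. mset is = mset js \<Longrightarrow> f is = f js" and j: "j < m"
  shows "(\<Sum>is\<in>off_tuples m n. f is * g (is ! j)) = (\<Sum>is\<in>off_tuples m n. f is * (g (is ! 0) :: real))"
proof -
  define s :: "nat list \<Rightarrow> nat list" where "s is = is[j := is ! 0, 0 := is ! j]" for "is"
  have len: "length is = m" if "is \<in> off_tuples m n" for "is"
    using that by (simp add: off_tuples_def index_set_def)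
  have ms: "mset (s is) = mset is" if "is \<in> off_tuples m n" for "is"
    using mset_swap[of 0 "is" j] j len[OF that] by (simp add: s_def)
  have mem: "s is \<in> off_tuples m n" if "is \<in> off_tuples m n" for "is"
    using off_tuples_cong_mset[OF ms[OF that]] that by simp
  have inv: "s (s is) = is" if "is \<in> off_tuples m n" for "is"
    using len[OF that] j unfolding s_def by (intro nth_equalityI) (auto simp: nth_list_update)
  have nth: "s is ! 0 = is ! j" if "is \<in> off_tuples m n" for "is"
    using len[OF that] j by (simp add: s_def)
  show ?thesis
    by (rule sum.reindex_bij_witness[of _ s s]) (auto simp: inv mem nth f[OF ms])
qed

text \<open>
  In the scaled variables \<open>z = x / d\<close>, the mean inequality bounds the monomial of each tuple \<open>is\<close> by
  the average of \<open>z (is ! j) ^ m\<close> over the positions \<open>j\<close>. By symmetry this average may be replaced,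
  after summation over the tuples, by the term for the first index. What remains is a combination
  of the rows with weights \<open>d i * z i ^ m\<close>, and each row is dominated by its diagonal entry.
\<close>

lemma gen_diag_dominant_imp_comparison_nonneg:
  assumes "m \<ge> 1" and A: "A \<in> sym_tensors m n"
    and nonneg: "\<And>i. i \<in> {1..n} \<Longrightarrow> A (replicate m i) \<ge> 0"
    and gdd: "gen_diag_dominant m n A"
  shows "comparison_nonneg m n A"
  unfolding comparison_nonneg_def
proof (intro allI impI)
  fix x :: "nat \<Rightarrow> real"
  assume x: "\<forall>i. 0 \<le> x i"
  obtain d where d: "\<And>i. i \<in> {1..n} \<Longrightarrow> d i > 0"
    and row: "\<And>i. i \<in> {1..n} \<Longrightarrow> off_row m n A d i \<le> A (replicate m i) * d i ^ (m - 1)"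
    using gen_diag_dominant_iff_off_row[of m n A] assms by metis
  define z where "z i = x i / d i" for i
  define f where "f is = \<bar>A is\<bar> * monomial d is" for "is"
  have z0: "0 \<le> z i" if "i \<in> {1..n}" for i using x d[OF that] by (simp add: z_def)
  have f_mset: "f is = f js" if "mset is = mset js" for "is" js
    using that sym_tensors_cong_mset[OF A that] monomial_cong_mset[OF that] by (simp add: f_def)
  have off: "length is = m" "set is \<subseteq> {1..n}" if "is \<in> off_tuples m n" for "is"
    using that by (auto simp: off_tuples_def index_set_def)
  have f0: "0 \<le> f is" if "is \<in> off_tuples m n" for "is"
    using off(2)[OF that] less_imp_le[OF d]
    by (auto simp: f_def subset_iff intro!: mult_nonneg_nonneg monomial_nonneg)
  have xz: "\<bar>A is\<bar> * monomial x is = f is * monomial z is" if "is \<in> off_tuples m n" for "is"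
  proof -
    have "monomial x is = monomial (\<lambda>i. d i * z i) is"
      using off[OF that] d by (intro monomial_cong) (force simp: z_def)
    then show ?thesis by (simp add: monomial_mult f_def)
  qed
  have "real m * (\<Sum>is\<in>off_tuples m n. \<bar>A is\<bar> * monomial x is)
      = (\<Sum>is\<in>off_tuples m n. f is * (m * monomial z is))"
    by (simp add: xz sum_distrib_left mult.left_commute)
  also have "\<dots> \<le> (\<Sum>is\<in>off_tuples m n. f is * (\<Sum>j<m. z (is ! j) ^ m))"
  proof (intro sum_mono mult_left_mono f0)
    fix "is" assume "is \<in> off_tuples m n"
    then show "m * monomial z is \<le> (\<Sum>j<m. z (is ! j) ^ m)"
      using monomial_le_sum_powers[of "is" z] off[of "is"] z0 by (metis subsetD)
  qed
  also have "\<dots> = (\<Sum>j<m. \<Sum>is\<in>off_tuples m n. f is * z (is ! j) ^ m)"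
    by (simp add: sum_distrib_left sum.swap[of _ "{..<m}"])
  also have "\<dots> = (\<Sum>j<m. \<Sum>is\<in>off_tuples m n. f is * z (is ! 0) ^ m)"
    by (intro sum.cong refl sum_off_tuples_position f_mset) auto
  also have "\<dots> = m * (\<Sum>is\<in>off_tuples m n. f is * z (is ! 0) ^ m)"
    by simp
  finally have "(\<Sum>is\<in>off_tuples m n. \<bar>A is\<bar> * monomial x is) \<le>
      (\<Sum>is\<in>off_tuples m n. f is * z (is ! 0) ^ m)"
    using assms(1) by simp
  also have "\<dots> = (\<Sum>i\<in>{1..n}. d i * z i ^ m * off_row m n A d i)"
    unfolding sum_off_tuples_by_head[OF assms(1)]
    by (simp add: f_def off_row_def sum_distrib_left mult_ac)
  also have "\<dots> \<le> (\<Sum>i\<in>{1..n}. d i * z i ^ m * (A (replicate m i) * d i ^ (m - 1)))"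
    using row d z0 by (intro sum_mono mult_left_mono) (auto intro!: mult_nonneg_nonneg simp: less_imp_le)
  also have "\<dots> = (\<Sum>i\<in>{1..n}. A (replicate m i) * x i ^ m)"
  proof (intro sum.cong refl)
    fix i assume "i \<in> {1..n}"
    then have "x i = d i * z i" using d[of i] by (simp add: z_def)
    moreover have "d i * d i ^ (m - 1) = d i ^ m" using assms(1) by (simp add: power_eq_if)
    ultimately show "d i * z i ^ m * (A (replicate m i) * d i ^ (m - 1)) = A (replicate m i) * x i ^ m"
      by (metis (no_types, lifting) power_mult_distrib mult.assoc mult.commute mult.left_commute)
  qed
  finally show "(\<Sum>is\<in>off_tuples m n. \<bar>A is\<bar> * monomial x is) \<le> (\<Sum>i\<in>{1..n}. A (replicate m i) * x i ^ m)" .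
qed

section \<open>Nonnegative comparison forms are generalized diagonally dominant\<close>

text \<open>
  Adding \<open>e > 0\<close> to the diagonal makes the comparison form coercive, and then the system
  \<open>c i * x i ^ (m - 1) = 1 + off_row m n A x i\<close> with \<open>c i = A (replicate m i) + e\<close> has a solution.
  It is found as a greatest fixed point. The right-hand side is monotone in \<open>x\<close>, and the set \<open>S\<close> of
  nonnegative subsolutions is bounded: weighting row \<open>i\<close> by \<open>x i\<close> and summing gives
  \<open>e * (\<Sum>i. x i ^ m) \<le> (\<Sum>i. x i)\<close>, where \<open>m \<ge> 2\<close>. The pointwise supremum \<open>s\<close> of \<open>S\<close> is below its
  own update \<open>y\<close>, hence \<open>y\<close> is again a subsolution and \<open>y = s\<close>. The constant \<open>1\<close> on the right-hand
  side forces the solution to be positive.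
\<close>

lemma comparison_nonneg_imp_perturbed_rows:
  assumes m: "m \<ge> 2" and cmp: "comparison_nonneg m n A"
    and nonneg: "\<And>i. i \<in> {1..n} \<Longrightarrow> A (replicate m i) \<ge> 0" and e: "e > 0"
  shows "\<exists>x. \<forall>i\<in>{1..n}. 0 < x i \<and> off_row m n A x i \<le> (A (replicate m i) + e) * x i ^ (m - 1)"
proof -
  define c where "c i = A (replicate m i) + e" for i
  define V where "V x i = 1 + off_row m n A x i" for x i
  define S where "S = {x :: nat \<Rightarrow> real. (\<forall>i. 0 \<le> x i) \<and> (\<forall>i\<in>{1..n}. c i * x i ^ (m - 1) \<le> V x i)}"
  define s where "s i = (if i \<in> {1..n} then SUP x\<in>S. x i else 0)" for i
  define y where "y i = (if i \<in> {1..n} then root (m - 1) (V s i / c i) else 0)" for i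
  have c: "c i > 0" if "i \<in> {1..n}" for i using nonneg[OF that] e by (simp add: c_def)
  have m1: "x * x ^ (m - 1) = x ^ m" for x :: real using m by (simp add: power_eq_if)
  have bound: "x i \<le> max 1 (n / e)" if x: "x \<in> S" and i: "i \<in> {1..n}" for x i
  proof -
    have x0: "0 \<le> x i" for i using x by (simp add: S_def)
    have "(\<Sum>i\<in>{1..n}. c i * x i ^ m) = (\<Sum>i\<in>{1..n}. x i * (c i * x i ^ (m - 1)))"
      by (simp add: mult.left_commute m1 del: One_nat_def)
    also have "\<dots> \<le> (\<Sum>i\<in>{1..n}. x i * V x i)"
      using x by (intro sum_mono mult_left_mono) (auto simp: S_def)
    also have "\<dots> = (\<Sum>i\<in>{1..n}. x i) + (\<Sum>i\<in>{1..n}. x i * off_row m n A x i)"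
      by (simp add: V_def algebra_simps sum.distrib)
    also have "\<dots> \<le> (\<Sum>i\<in>{1..n}. x i) + (\<Sum>i\<in>{1..n}. A (replicate m i) * x i ^ m)"
      using comparison_nonneg_rows[OF _ cmp] x0 m by simp
    finally have sum: "e * (\<Sum>i\<in>{1..n}. x i ^ m) \<le> (\<Sum>i\<in>{1..n}. x i)"
      by (simp add: c_def algebra_simps sum.distrib sum_distrib_left)
    \<comment> \<open>If the largest coordinate \<open>x j\<close> exceeds 1, then \<open>e * x j ^ 2 \<le> e * x j ^ m \<le> n * x j\<close>.\<close>
    obtain j where j: "j \<in> {1..n}" and max: "\<And>i. i \<in> {1..n} \<Longrightarrow> x i \<le> x j"
    proof -
      have "x ` {1..n} \<noteq> {}" using i by auto
      then have "Max (x ` {1..n}) \<in> x ` {1..n}" by (intro Max_in) auto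
      then obtain j where "j \<in> {1..n}" "x j = Max (x ` {1..n})" by auto
      then show thesis using that[of j] Max_ge[of "x ` {1..n}"] by simp
    qed
    have "e * x j ^ m \<le> e * (\<Sum>i\<in>{1..n}. x i ^ m)"
      using e j x0 by (intro mult_left_mono member_le_sum) auto
    also have "\<dots> \<le> n * x j"
      using sum sum_bounded_above[of "{1..n}" x "x j"] max by auto
    finally have le: "e * x j ^ m \<le> n * x j" .
    have "x j \<le> max 1 (n / e)"
    proof (cases "x j \<le> 1")
      case False
      then have "x j ^ 2 \<le> x j ^ m" using m by (intro power_increasing) auto
      then have "e * x j ^ 2 \<le> n * x j" using le e by (smt (verit) mult_left_mono)
      then have "e * x j \<le> n" using False by (simp add: power2_eq_square)
      then show ?thesis using e by (simp add: le_max_iff_disj field_simps)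
    qed auto
    then show ?thesis using max[OF i] by linarith
  qed
  have bdd: "bdd_above ((\<lambda>x. x i) ` S)" if "i \<in> {1..n}" for i
    using bound[OF _ that] by (auto simp: bdd_above_def)
  have zero: "(\<lambda>_. 0) \<in> S"
    using m off_row_nonneg[of n "\<lambda>_. 0" m A] by (auto simp: S_def V_def power_0_left add_nonneg_nonneg)
  have le_s: "x i \<le> s i" if "x \<in> S" "i \<in> {1..n}" for x i
    using cSUP_upper[OF that(1) bdd[OF that(2)]] that(2) by (simp add: s_def)
  have s0: "0 \<le> s i" for i
    using le_s[OF zero, of i] by (cases "i \<in> {1..n}") (auto simp: s_def)
  have V1: "1 \<le> V s i" for i using off_row_nonneg[of n s] s0 by (simp add: V_def)
  have ypow: "c i * y i ^ (m - 1) = V s i" if "i \<in> {1..n}" for i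
  proof -
    have "0 \<le> V s i / c i" using V1[of i] c[OF that] by simp
    then show ?thesis using that c[OF that] m by (simp add: y_def)
  qed
  have y0: "0 \<le> y i" for i
    using V1[of i] c[of i] m by (auto simp: y_def intro!: real_root_ge_zero divide_nonneg_pos)
  \<comment> \<open>Every subsolution lies below \<open>y\<close>, since its right-hand side is at most that of \<open>s\<close>.\<close>
  have s_le_y: "s i \<le> y i" for i
  proof (cases "i \<in> {1..n}")
    case i: True
    have "x i \<le> y i" if x: "x \<in> S" for x
    proof -
      have "c i * x i ^ (m - 1) \<le> V x i" using x i by (simp add: S_def)
      also have "\<dots> \<le> V s i"
        using off_row_mono[of n x s] le_s[OF x] x by (simp add: V_def S_def)
      finally have "x i ^ (m - 1) \<le> y i ^ (m - 1)" using c[OF i] ypow[OF i] by (metis mult_le_cancel_left_pos)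
      then show ?thesis using power_mono_iff[of "x i" "y i" "m - 1"] y0[of i] x m by (simp add: S_def)
    qed
    then show ?thesis using i zero by (auto simp: s_def intro!: cSUP_least)
  qed (auto simp: s_def y_def)
  have "c i * y i ^ (m - 1) \<le> V y i" if "i \<in> {1..n}" for i
    using ypow[OF that] off_row_mono[of n s y] s0 s_le_y by (simp add: V_def)
  then have "y \<in> S" using y0 by (simp add: S_def)
  then have y_le_s: "y i \<le> s i" if "i \<in> {1..n}" for i using le_s that by blast
  show ?thesis
  proof (intro exI[of _ y] ballI conjI)
    fix i assume i: "i \<in> {1..n}"
    show "0 < y i" using i m V1[of i] c[OF i] by (simp add: y_def)
    show "off_row m n A y i \<le> (A (replicate m i) + e) * y i ^ (m - 1)"
      using ypow[OF i] off_row_mono[of n y s m A i] y0 y_le_s by (simp add: c_def V_def)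
  qed
qed

text \<open>
  A scaling vector that satisfies the row inequalities cannot have very different values at two
  indices that are coupled by a nonzero entry. It suffices to compare with the index \<open>r\<close> of the
  smallest value in the tuple: for \<open>q \<noteq> r\<close>, the entry at \<open>is\<close> contributes at least
  \<open>\<bar>A is\<bar> * x q * x r ^ (m - 2)\<close> to row \<open>r\<close>, while the row is at most \<open>C * x r ^ (m - 1)\<close>.
\<close>

lemma row_bound_imp_ratio_bound:
  assumes m: "m \<ge> 2" and A: "A \<in> sym_tensors m n"
    and x: "\<And>i. i \<in> {1..n} \<Longrightarrow> 0 < x i"
    and row: "\<And>i. i \<in> {1..n} \<Longrightarrow> off_row m n A x i \<le> C * x i ^ (m - 1)"
    and "is": "is \<in> off_tuples m n" "A is \<noteq> 0" and pq: "p \<in> set is" "q \<in> set is"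
  shows "x q \<le> max 1 (C / \<bar>A is\<bar>) * x p"
proof -
  have sub: "set is \<subseteq> {1..n}" and len: "length is = m"
    using "is" by (auto simp: off_tuples_def index_set_def)
  obtain r where r: "r \<in> set is" and min: "\<And>i. i \<in> set is \<Longrightarrow> x r \<le> x i"
  proof -
    have "Min (x ` set is) \<in> x ` set is" using pq by (intro Min_in) auto
    then obtain r where "r \<in> set is" "x r = Min (x ` set is)" by auto
    then show thesis using that[of r] Min_le[of "x ` set is"] by simp
  qed
  have xr: "0 < x r" using x r sub by auto
  have "x q \<le> max 1 (C / \<bar>A is\<bar>) * x r"
  proof (cases "q = r")
    case True
    have "1 * x r \<le> max 1 (C / \<bar>A is\<bar>) * x r" using xr by (intro mult_right_mono) auto
    then show ?thesis using True by simp
  next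
    case False
    define js where "js = remove1 r is"
    have ms: "mset (r # js) = mset is" using r by (simp add: js_def)
    have js: "js \<in> index_set (m - 1) n - {replicate (m - 1) r}"
      using Cons_in_off_tuples[of m r js n] off_tuples_cong_mset[OF ms] "is" m by auto
    have q: "q \<in> set js" using pq False by (simp add: js_def)
    have "x r ^ (m - 2) = monomial (\<lambda>_. x r) (remove1 q js)"
      using q r len by (simp add: monomial_def map_replicate_const js_def length_remove1 numeral_2_eq_2)
    also have "\<dots> \<le> monomial x (remove1 q js)"
      using xr min by (intro monomial_mono) (auto simp: js_def dest!: notin_set_remove1[THEN contrapos_pp])
    finally have "x q * x r ^ (m - 2) \<le> x q * monomial x (remove1 q js)"
      using less_imp_le[OF x] pq sub by (intro mult_left_mono) auto
    also have "\<dots> = monomial x js"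
      using monomial_cong_mset[of "q # remove1 q js" js x] q by simp
    finally have "\<bar>A is\<bar> * (x q * x r ^ (m - 2)) \<le> \<bar>A is\<bar> * monomial x js"
      by (intro mult_left_mono) auto
    also have "\<dots> \<le> off_row m n A x r"
    proof -
      have "\<bar>A (r # js)\<bar> * monomial x js \<le> off_row m n A x r"
        unfolding off_row_def
      proof (rule member_le_sum[OF js])
        fix ks assume "ks \<in> index_set (m - 1) n - {replicate (m - 1) r} - {js}"
        then have "0 \<le> monomial x ks"
          using less_imp_le[OF x] by (auto simp: index_set_def subset_iff intro!: monomial_nonneg)
        then show "0 \<le> \<bar>A (r # ks)\<bar> * monomial x ks" by simp
      qed simp
      then show ?thesis using sym_tensors_cong_mset[OF A ms] by simp
    qed
    also have "\<dots> \<le> C * x r ^ (m - 1)" using row r sub by auto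
    also have "x r ^ (m - 1) = x r * x r ^ (m - 2)" using m by (simp add: power_eq_if numeral_2_eq_2 Suc_diff_Suc)
    finally have "\<bar>A is\<bar> * x q \<le> C * x r" using xr by (simp add: mult_ac)
    then have "x q \<le> C / \<bar>A is\<bar> * x r" using "is" by (simp add: field_simps)
    also have "\<dots> \<le> max 1 (C / \<bar>A is\<bar>) * x r" using xr by (intro mult_right_mono) auto
    finally show ?thesis .
  qed
  also have "\<dots> \<le> max 1 (C / \<bar>A is\<bar>) * x p" using min[OF pq(1)] by (intro mult_left_mono) auto
  finally show ?thesis .
qed

lemma tendsto_monomial:
  "(\<And>p. p \<in> set is \<Longrightarrow> (\<lambda>k. w k p) \<longlonglongrightarrow> l p) \<Longrightarrow> (\<lambda>k. monomial (w k) is) \<longlonglongrightarrow> monomial l is"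
  by (induction "is") (auto intro!: tendsto_mult)

text \<open>
  The scaling vector is a limit of the solutions \<open>x k\<close> for the diagonal perturbed by \<open>1 / (k + 1)\<close>.
  These may degenerate, because different connected components of the coupling relation \<open>R\<close> can
  drift apart. Within a component, however, all ratios are bounded above and below uniformly in
  \<open>k\<close>, and a row involves one component only, so its inequality is homogeneous of degree \<open>m - 1\<close>
  under rescaling of that component. Dividing each component by the value at a chosen
  representative therefore preserves all row inequalities and makes the vectors range over a
  compact set of positive vectors.
\<close>

lemma comparison_nonneg_imp_gen_diag_dominant:
  assumes m: "m \<ge> 2" and A: "A \<in> sym_tensors m n" and cmp: "comparison_nonneg m n A"
    and nonneg: "\<And>i. i \<in> {1..n} \<Longrightarrow> A (replicate m i) \<ge> 0"
  shows "gen_diag_dominant m n A"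
proof -
  define e :: "nat \<Rightarrow> real" where "e k = inverse (real (Suc k))" for k
  have e: "0 < e k" "e k \<le> 1" for k by (auto simp: e_def divide_simps)
  have "\<forall>k. \<exists>x. \<forall>i\<in>{1..n}. 0 < x i \<and> off_row m n A x i \<le> (A (replicate m i) + e k) * x i ^ (m - 1)"
    using comparison_nonneg_imp_perturbed_rows[OF m cmp nonneg e(1)] by blast
  then obtain x where x: "\<And>k i. i \<in> {1..n} \<Longrightarrow> 0 < x k i"
    and row: "\<And>k i. i \<in> {1..n} \<Longrightarrow> off_row m n A (x k) i \<le> (A (replicate m i) + e k) * x k i ^ (m - 1)"
    by metis
  \<comment> \<open>Bounds the diagonal entries uniformly in the row and in \<open>k\<close>, as the perturbations are at most 1.\<close>
  define C where "C = (\<Sum>i\<in>{1..n}. A (replicate m i)) + 1"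
  have rowC: "off_row m n A (x k) i \<le> C * x k i ^ (m - 1)" if i: "i \<in> {1..n}" for k i
  proof -
    have "A (replicate m i) \<le> (\<Sum>i\<in>{1..n}. A (replicate m i))"
      using i nonneg by (intro member_le_sum[where f = "\<lambda>i. A (replicate m i)"]) auto
    then have "A (replicate m i) + e k \<le> C" using e(2)[of k] by (simp add: C_def)
    then have "(A (replicate m i) + e k) * x k i ^ (m - 1) \<le> C * x k i ^ (m - 1)"
      using x[OF i, of k] by (intro mult_right_mono) auto
    then show ?thesis using row[OF i, of k] by linarith
  qed
  define R where "R = {(p, q). \<exists>is\<in>off_tuples m n. A is \<noteq> 0 \<and> p \<in> set is \<and> q \<in> set is}"
  have R_dom: "p \<in> {1..n}" "q \<in> {1..n}" if "(p, q) \<in> R" for p q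
    using that by (auto simp: R_def off_tuples_def index_set_def)
  have "sym R" by (auto simp: R_def sym_def)
  then have symR: "(q, p) \<in> R\<^sup>*" if "(p, q) \<in> R\<^sup>*" for p q
    using that by (metis sym_rtrancl symD)
  have ratio: "\<exists>K>0. \<forall>k. x k q \<le> K * x k p" if "(p, q) \<in> R\<^sup>*" for p q
    using that
  proof (induction rule: rtrancl_induct)
    case base
    then show ?case by (intro exI[of _ 1]) auto
  next
    case (step q r)
    then obtain K where K: "K > 0" "\<And>k. x k q \<le> K * x k p" by auto
    obtain "is" where "is": "is \<in> off_tuples m n" "A is \<noteq> 0" "q \<in> set is" "r \<in> set is"
      using step(2) by (auto simp: R_def)
    define L where "L = max 1 (C / \<bar>A is\<bar>)"
    have L: "L > 0" by (simp add: L_def)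
    have "x k r \<le> L * K * x k p" for k
    proof -
      have "x k r \<le> L * x k q"
        unfolding L_def by (rule row_bound_imp_ratio_bound[OF m A x rowC "is"])
      also have "\<dots> \<le> L * (K * x k p)" using K L by (intro mult_left_mono) auto
      finally show ?thesis by (simp add: mult.assoc)
    qed
    then show ?case using K L by (intro exI[of _ "L * K"]) auto
  qed
  \<comment> \<open>The choice depends on the component only, because it depends on the set of reachable indices only.\<close>
  define rep where "rep p = (SOME q. (p, q) \<in> R\<^sup>*)" for p
  have rep: "(p, rep p) \<in> R\<^sup>*" for p unfolding rep_def by (rule someI) (rule rtrancl_refl)
  have rep_eq: "rep p = rep q" if "(p, q) \<in> R" for p q
  proof -
    have "(p, r) \<in> R\<^sup>* \<longleftrightarrow> (q, r) \<in> R\<^sup>*" for r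
      using that symR by (meson r_into_rtrancl rtrancl_trans)
    then show ?thesis by (simp add: rep_def)
  qed
  have rep_dom: "rep p \<in> {1..n}" if "p \<in> {1..n}" for p
    using rep[of p] that by (induction rule: rtrancl_induct) (auto dest: R_dom)
  define w where "w k p = x k p / x k (rep p)" for k p
  have w_pos: "0 < w k p" if "p \<in> {1..n}" for k p
    using x[OF that] x[OF rep_dom[OF that]] by (simp add: w_def)
  have "\<exists>U. \<forall>k. w k p \<le> U" if p: "p \<in> {1..n}" for p
    using ratio[OF symR[OF rep[of p]]] x[OF rep_dom[OF p]] by (auto simp: w_def divide_simps)
  then obtain U where U: "\<And>k p. p \<in> {1..n} \<Longrightarrow> w k p \<le> U p" by metis
  have "\<exists>L>0. \<forall>k. L \<le> w k p" if p: "p \<in> {1..n}" for p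
  proof -
    obtain K where "K > 0" "\<And>k. x k (rep p) \<le> K * x k p" using ratio[OF rep[of p]] by auto
    then show ?thesis using x[OF rep_dom[OF p]]
      by (intro exI[of _ "1 / K"]) (auto simp: w_def divide_simps mult.commute)
  qed
  then obtain L where L: "\<And>p. p \<in> {1..n} \<Longrightarrow> 0 < L p" "\<And>k p. p \<in> {1..n} \<Longrightarrow> L p \<le> w k p" by metis
  have "norm (w k p) \<le> (\<Sum>q\<in>{1..n}. \<bar>U q\<bar>)" if p: "p \<in> {1..n}" for k p
  proof -
    have "\<bar>U p\<bar> \<le> (\<Sum>q\<in>{1..n}. \<bar>U q\<bar>)" using p by (intro member_le_sum[where f = "\<lambda>p. \<bar>U p\<bar>"]) auto
    then show ?thesis using U[OF p, of k] w_pos[OF p, of k] by simp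
  qed
  then obtain \<sigma> where \<sigma>: "strict_mono (\<sigma> :: nat \<Rightarrow> nat)"
      and conv: "\<And>p. p \<in> {1..n} \<Longrightarrow> \<exists>l. (\<lambda>k. w (\<sigma> k) p) \<longlonglongrightarrow> l"
    using function_convergent_subsequence[of "{1..n}" w] by (metis countable_finite finite_atLeastAtMost)
  then obtain d where d: "\<And>p. p \<in> {1..n} \<Longrightarrow> (\<lambda>k. w (\<sigma> k) p) \<longlonglongrightarrow> d p" by metis
  have d_pos: "0 < d p" if "p \<in> {1..n}" for p
    using LIMSEQ_le_const[OF d[OF that], of "L p"] L[OF that] by force
  have row_w: "off_row m n A (w k) i \<le> (A (replicate m i) + e k) * w k i ^ (m - 1)"
    if i: "i \<in> {1..n}" for k i
  proof -
    define t where "t = x k (rep i)"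
    have t: "t > 0" using x[OF rep_dom[OF i]] by (simp add: t_def)
    have "\<bar>A (i # js)\<bar> * monomial (x k) js = t ^ (m - 1) * (\<bar>A (i # js)\<bar> * monomial (w k) js)"
      if js: "js \<in> index_set (m - 1) n - {replicate (m - 1) i}" for js
    proof (cases "A (i # js) = 0")
      case False
      have "i # js \<in> off_tuples m n" using Cons_in_off_tuples[of m i js n] i js m by simp
      then have "(p, i) \<in> R" if "p \<in> set js" for p
        using False that by (force simp: R_def)
      then have "x k p = t * w k p" if "p \<in> set js" for p
        using rep_eq[of p i] that t by (simp add: w_def t_def)
      then have "monomial (x k) js = monomial (\<lambda>p. t * w k p) js" by (rule monomial_cong)
      also have "\<dots> = t ^ (m - 1) * monomial (w k) js"
        using js by (simp add: monomial_mult) (simp add: monomial_def map_replicate_const index_set_def)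
      finally show ?thesis by simp
    qed simp
    then have "off_row m n A (x k) i = t ^ (m - 1) * off_row m n A (w k) i"
      unfolding off_row_def sum_distrib_left by (intro sum.cong refl)
    moreover have "x k i ^ (m - 1) = t ^ (m - 1) * w k i ^ (m - 1)"
      using t by (simp add: w_def t_def power_divide)
    ultimately have "t ^ (m - 1) * off_row m n A (w k) i \<le>
        t ^ (m - 1) * ((A (replicate m i) + e k) * w k i ^ (m - 1))"
      using row[OF i, of k] by (simp add: mult_ac)
    then show ?thesis using t by simp
  qed
  have "e \<longlonglongrightarrow> 0" unfolding e_def by (rule LIMSEQ_inverse_real_of_nat)
  then have e_lim: "(\<lambda>k. e (\<sigma> k)) \<longlonglongrightarrow> 0"
    using LIMSEQ_subseq_LIMSEQ[OF _ \<sigma>] by (fastforce simp: o_def)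
  have "off_row m n A d i \<le> A (replicate m i) * d i ^ (m - 1)" if i: "i \<in> {1..n}" for i
  proof (rule LIMSEQ_le)
    show "(\<lambda>k. off_row m n A (w (\<sigma> k)) i) \<longlonglongrightarrow> off_row m n A d i"
      unfolding off_row_def
      by (intro tendsto_sum tendsto_mult tendsto_const tendsto_monomial d) (auto simp: index_set_def)
    have "(\<lambda>k. (A (replicate m i) + e (\<sigma> k)) * w (\<sigma> k) i ^ (m - 1))
        \<longlonglongrightarrow> (A (replicate m i) + 0) * d i ^ (m - 1)"
      by (intro tendsto_intros e_lim d i)
    then show "(\<lambda>k. (A (replicate m i) + e (\<sigma> k)) * w (\<sigma> k) i ^ (m - 1))
        \<longlonglongrightarrow> A (replicate m i) * d i ^ (m - 1)" by simp
    show "\<exists>N. \<forall>k\<ge>N. off_row m n A (w (\<sigma> k)) i \<le> (A (replicate m i) + e (\<sigma> k)) * w (\<sigma> k) i ^ (m - 1)"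
      using row_w[OF i] by blast
  qed
  then show ?thesis
    using gen_diag_dominant_iff_off_row[of m n A] nonneg d_pos m
    by (metis One_nat_def Suc_1 Suc_leD)
qed

section \<open>Closure under sums\<close>

lemma GDD_plus_iff_comparison_nonneg:
  assumes "m \<ge> 2" and "A \<in> sym_tensors m n"
    and "\<And>i. i \<in> {1..n} \<Longrightarrow> A (replicate m i) \<ge> 0"
  shows "A \<in> GDD_plus m n \<longleftrightarrow> comparison_nonneg m n A"
  using gen_diag_dominant_imp_comparison_nonneg[of m A n]
    comparison_nonneg_imp_gen_diag_dominant[of m A n] assms
  by (auto simp: GDD_plus_def)

text \<open>
  The scaling vectors of the summands are unrelated, so they are eliminated first: in the comparison form the diagonal parts add up and, by the triangle inequality, the
  off-diagonal part is subadditive.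
\<close>

lemma sum_in_GDD_plus:
  assumes m: "m \<ge> 2" and B: "\<And>k. k \<in> K \<Longrightarrow> B k \<in> GDD_plus m n"
  shows "(\<lambda>is. \<Sum>k\<in>K. B k is) \<in> GDD_plus m n"
proof -
  have nonneg: "B k (replicate m i) \<ge> 0" if "k \<in> K" "i \<in> {1..n}" for k i
    using B[OF that(1)] that(2) by (simp add: GDD_plus_def)
  have cmp: "comparison_nonneg m n (B k)" if "k \<in> K" for k
    using gen_diag_dominant_imp_comparison_nonneg[of m "B k" n] B[OF that] m
    unfolding GDD_plus_def by force
  have "comparison_nonneg m n (\<lambda>is. \<Sum>k\<in>K. B k is)"
    unfolding comparison_nonneg_def
  proof (intro allI impI)
    fix x :: "nat \<Rightarrow> real" assume x: "\<forall>i. 0 \<le> x i"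
    have "(\<Sum>is\<in>off_tuples m n. \<bar>\<Sum>k\<in>K. B k is\<bar> * monomial x is)
        \<le> (\<Sum>is\<in>off_tuples m n. (\<Sum>k\<in>K. \<bar>B k is\<bar>) * monomial x is)"
      using x by (intro sum_mono mult_right_mono sum_abs monomial_nonneg) auto
    also have "\<dots> = (\<Sum>k\<in>K. \<Sum>is\<in>off_tuples m n. \<bar>B k is\<bar> * monomial x is)"
      by (subst sum.swap) (simp add: sum_distrib_right)
    also have "\<dots> \<le> (\<Sum>k\<in>K. \<Sum>i\<in>{1..n}. B k (replicate m i) * x i ^ m)"
      using cmp x by (intro sum_mono) (simp add: comparison_nonneg_def)
    also have "\<dots> = (\<Sum>i\<in>{1..n}. (\<Sum>k\<in>K. B k (replicate m i)) * x i ^ m)"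
      by (subst sum.swap) (simp add: sum_distrib_right)
    finally show "(\<Sum>is\<in>off_tuples m n. \<bar>\<Sum>k\<in>K. B k is\<bar> * monomial x is)
        \<le> (\<Sum>i\<in>{1..n}. (\<Sum>k\<in>K. B k (replicate m i)) * x i ^ m)" .
  qed
  moreover have "(\<lambda>is. \<Sum>k\<in>K. B k is) \<in> sym_tensors m n"
  proof -
    have sym: "B k \<in> sym_tensors m n" if "k \<in> K" for k using B[OF that] by (simp add: GDD_plus_def)
    then have "B k is = 0" if "k \<in> K" "is \<notin> index_set m n" for k "is"
      using that by (simp add: sym_tensors_def)
    moreover have "(\<Sum>k\<in>K. B k is) = (\<Sum>k\<in>K. B k js)" if "mset is = mset js" for "is" js
      using sym_tensors_cong_mset[OF sym that] by (rule sum.cong[OF refl])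
    ultimately show ?thesis by (intro sym_tensorsI sum.neutral) blast+
  qed
  ultimately show ?thesis
    using GDD_plus_iff_comparison_nonneg[OF m] nonneg sum_nonneg by (metis (no_types, lifting))
qed

section \<open>Splitting a tensor into simple tensors\<close>

definition class_row :: "nat \<Rightarrow> nat \<Rightarrow> (nat list \<Rightarrow> real) \<Rightarrow> (nat \<Rightarrow> real) \<Rightarrow> nat list \<Rightarrow> nat \<Rightarrow> real" where
  "class_row m n A d \<alpha> i =
     (\<Sum>js | js \<in> index_set (m - 1) n \<and> mset (i # js) = mset \<alpha>. \<bar>A (i # js)\<bar> * monomial d js)"

text \<open>
  The entries of \<open>A\<close> on the permutations of \<open>\<alpha>\<close>, together with the smallest diagonal entries for
  which this part is diagonally dominant under the scaling \<open>d\<close>. No case distinction on \<open>p \<in> set \<alpha>\<close> is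
  made for the diagonal: for other \<open>p\<close> the sum \<open>class_row m n A d \<alpha> p\<close> is empty.
\<close>

definition class_part ::
    "nat \<Rightarrow> nat \<Rightarrow> (nat list \<Rightarrow> real) \<Rightarrow> (nat \<Rightarrow> real) \<Rightarrow> nat list \<Rightarrow> nat list \<Rightarrow> real" where
  "class_part m n A d \<alpha> is =
     (if is \<notin> index_set m n then 0
      else if mset is = mset \<alpha> then A is
      else if is = replicate m (hd is) then class_row m n A d \<alpha> (hd is) / d (hd is) ^ (m - 1)
      else 0)"

definition diag_single :: "nat \<Rightarrow> nat \<Rightarrow> real \<Rightarrow> nat list \<Rightarrow> real" where
  "diag_single m i v is = (if is = replicate m i then v else 0)"

lemma offdiag_indices_eq: "offdiag_indices m n = {is \<in> off_tuples m n. sorted is}"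
  by (auto simp: offdiag_indices_def off_tuples_def)

lemma finite_offdiag_indices [simp]: "finite (offdiag_indices m n)"
  by (simp add: offdiag_indices_eq)

lemma mset_eq_iff_sort_eq: "\<alpha> \<in> offdiag_indices m n \<Longrightarrow> mset is = mset \<alpha> \<longleftrightarrow> sort is = \<alpha>"
  using properties_for_sort[of \<alpha> "is"] by (auto simp: offdiag_indices_eq)

lemma sort_in_offdiag_indices: "is \<in> off_tuples m n \<Longrightarrow> sort is \<in> offdiag_indices m n"
  using off_tuples_cong_mset[of "sort is" "is" m n] by (simp add: offdiag_indices_eq)

lemma class_part_replicate:
  assumes "m \<ge> 1" "\<alpha> \<in> offdiag_indices m n" "i \<in> {1..n}"
  shows "class_part m n A d \<alpha> (replicate m i) = class_row m n A d \<alpha> i / d i ^ (m - 1)"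
proof -
  have "mset (replicate m i) \<noteq> mset \<alpha>"
    using eq_replicate_cong_mset[of "replicate m i" \<alpha> m i] assms(2)
    by (auto simp: offdiag_indices_eq off_tuples_def)
  moreover have "hd (replicate m i) = i" using assms(1) by (cases m) auto
  ultimately show ?thesis
    using replicate_in_index_set[OF assms(3), of m] by (simp add: class_part_def)
qed

lemma class_part_off_tuples:
  assumes "is \<in> off_tuples m n"
  shows "class_part m n A d \<alpha> is = (if mset is = mset \<alpha> then A is else 0)"
  using assms by (auto simp: class_part_def off_tuples_def)

lemma class_part_in_sym_tensors:
  assumes A: "A \<in> sym_tensors m n"
  shows "class_part m n A d \<alpha> \<in> sym_tensors m n"
proof -
  have "class_part m n A d \<alpha> is = class_part m n A d \<alpha> js" if "mset is = mset js" for "is" js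
  proof (cases "is = replicate m (hd is)")
    case True
    then have "js = is" using eq_replicate_cong_mset[OF that, of m "hd is"] by simp
    then show ?thesis by simp
  next
    case False
    then have "js \<noteq> replicate m (hd js)"
      by (metis eq_replicate_cong_mset that)
    then show ?thesis
      using False that index_set_cong_mset[OF that, of m n] sym_tensors_cong_mset[OF A that]
      by (simp add: class_part_def)
  qed
  moreover have "class_part m n A d \<alpha> is = 0" if "is \<notin> index_set m n" for "is"
    using that by (simp add: class_part_def)
  ultimately show ?thesis by (intro sym_tensorsI) blast+
qed

lemma off_row_class_part:
  assumes "m \<ge> 1" and \<alpha>: "\<alpha> \<in> offdiag_indices m n" and i: "i \<in> {1..n}"
  shows "off_row m n (class_part m n A d \<alpha>) d i = class_row m n A d \<alpha> i"
proof -
  have mem: "js \<in> index_set (m - 1) n - {replicate (m - 1) i} \<longleftrightarrow> i # js \<in> off_tuples m n" for js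
    using Cons_in_off_tuples[OF assms(1)] i by blast
  have "off_row m n (class_part m n A d \<alpha>) d i =
      (\<Sum>js\<in>index_set (m - 1) n - {replicate (m - 1) i}.
         if mset (i # js) = mset \<alpha> then \<bar>A (i # js)\<bar> * monomial d js else 0)"
    unfolding off_row_def
    by (intro sum.cong refl) (simp only: mem class_part_off_tuples split: if_split, simp)
  also have "\<dots> = class_row m n A d \<alpha> i"
  proof -
    have "mset (i # js) = mset \<alpha> \<Longrightarrow> i # js \<in> off_tuples m n" for js
      using off_tuples_cong_mset[of "i # js" \<alpha> m n] \<alpha> by (simp add: offdiag_indices_eq)
    then have "{js \<in> index_set (m - 1) n. mset (i # js) = mset \<alpha>} =
        {js \<in> index_set (m - 1) n - {replicate (m - 1) i}. mset (i # js) = mset \<alpha>}"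
      using mem by blast
    then show ?thesis
      unfolding class_row_def by (simp add: sum.inter_filter del: mset.simps Diff_iff)
  qed
  finally show ?thesis .
qed

text \<open>
  Every row inequality of a class part holds with equality under the scaling \<open>d\<close>. The part vanishes at
  the diagonal positions of indices outside \<open>\<alpha>\<close>, because no permutation of \<open>\<alpha>\<close> starts with them.
\<close>

lemma class_part_in_simple_GDD_plus:
  assumes m: "m \<ge> 1" and A: "A \<in> sym_tensors m n" and d: "\<And>i. i \<in> {1..n} \<Longrightarrow> 0 < d i"
    and \<alpha>: "\<alpha> \<in> offdiag_indices m n"
  shows "class_part m n A d \<alpha> \<in> simple_tensors m n \<inter> GDD_plus m n"
proof
  have "class_part m n A d \<alpha> is = 0"
    if "is \<in> index_set m n" "is \<notin> perm_tuples \<alpha> \<union> diag_tuples \<alpha>" for "is"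
  proof (cases "is = replicate m (hd is)")
    case True
    have "length \<alpha> = m" using \<alpha> by (simp add: offdiag_indices_def index_set_def)
    then have "hd is \<notin> set \<alpha>" using that True unfolding diag_tuples_def by blast
    then have "mset (hd is # js) \<noteq> mset \<alpha>" for js by (metis list.set_intros(1) mset_eq_setD)
    then have "class_row m n A d \<alpha> (hd is) = 0" by (simp add: class_row_def)
    then show ?thesis using that by (simp add: class_part_def perm_tuples_def)
  qed (use that in \<open>simp add: class_part_def perm_tuples_def\<close>)
  then show "class_part m n A d \<alpha> \<in> simple_tensors m n"
    using \<alpha> class_part_in_sym_tensors[OF A, of d \<alpha>]
    unfolding simple_tensors_def simple_tensors_at_def by blast
next
  have row0: "0 \<le> class_row m n A d \<alpha> i" for i
    using less_imp_le[OF d]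
    by (auto simp: class_row_def index_set_def subset_iff intro!: sum_nonneg mult_nonneg_nonneg monomial_nonneg)
  have nonneg: "class_part m n A d \<alpha> (replicate m i) \<ge> 0" if "i \<in> {1..n}" for i
    using class_part_replicate[OF m \<alpha> that] row0 d[OF that] by simp
  have "off_row m n (class_part m n A d \<alpha>) d i \<le> class_part m n A d \<alpha> (replicate m i) * d i ^ (m - 1)"
    if "i \<in> {1..n}" for i
    using class_part_replicate[OF m \<alpha> that, of A d] off_row_class_part[OF m \<alpha> that, of A d] d[OF that]
    by simp
  then have "gen_diag_dominant m n (class_part m n A d \<alpha>)"
    using gen_diag_dominant_iff_off_row[of m n "class_part m n A d \<alpha>"] nonneg d m by metis
  then show "class_part m n A d \<alpha> \<in> GDD_plus m n"
    using class_part_in_sym_tensors[OF A] nonneg by (auto simp: GDD_plus_def)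
qed

text \<open>
  A tensor that is concentrated on the diagonal is simple for every class that contains its index; as
  \<open>n \<ge> 2\<close>, there is a second index \<open>j\<close>, which yields a class that is not constant.
\<close>

lemma diag_single_in_simple_GDD_plus:
  assumes m: "m \<ge> 2" and n: "n \<ge> 2" and i: "i \<in> {1..n}" and v: "v \<ge> 0"
  shows "diag_single m i v \<in> simple_tensors m n \<inter> GDD_plus m n"
proof
  have sym: "diag_single m i v \<in> sym_tensors m n"
  proof (rule sym_tensorsI)
    show "diag_single m i v is = 0" if "is \<notin> index_set m n" for "is"
      using that i by (auto simp: diag_single_def replicate_in_index_set)
    show "diag_single m i v is = diag_single m i v js" if "mset is = mset js" for "is" js
      using eq_replicate_cong_mset[OF that, of m i] by (simp add: diag_single_def)
  qed
  obtain j where j: "j \<in> {1..n}" "j \<noteq> i" using n that[of 1] that[of 2] by (cases "i = 1") auto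
  define \<alpha> where "\<alpha> = sort (i # replicate (m - 1) j)"
  have "i # replicate (m - 1) j \<in> off_tuples m n"
    using Cons_in_off_tuples[of m] i j m replicate_in_index_set[OF j(1)] by (auto simp: replicate_eq_replicate)
  then have \<alpha>: "\<alpha> \<in> offdiag_indices m n" unfolding \<alpha>_def by (rule sort_in_offdiag_indices)
  have "length \<alpha> = m" "i \<in> set \<alpha>" using m by (auto simp: \<alpha>_def simp del: sort_key_simps)
  then have "replicate m i \<in> diag_tuples \<alpha>" by (auto simp: diag_tuples_def)
  then show "diag_single m i v \<in> simple_tensors m n"
    using \<alpha> sym unfolding simple_tensors_def simple_tensors_at_def by (force simp: diag_single_def)
  have nonneg: "diag_single m i v (replicate m p) \<ge> 0" for p using v by (simp add: diag_single_def)
  have "off_row m n (diag_single m i v) (\<lambda>_. 1) p = 0" if "p \<in> {1..n}" for p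
    unfolding off_row_def
  proof (intro sum.neutral ballI)
    fix js assume "js \<in> index_set (m - 1) n - {replicate (m - 1) p}"
    then have "p # js \<in> off_tuples m n" using Cons_in_off_tuples[of m p js n] m that by simp
    then show "\<bar>diag_single m i v (p # js)\<bar> * monomial (\<lambda>_. 1) js = 0"
      by (auto simp: off_tuples_def diag_single_def)
  qed
  then have "\<forall>p\<in>{1..n}. (1::real) > 0 \<and> off_row m n (diag_single m i v) (\<lambda>_. 1) p
      \<le> diag_single m i v (replicate m p) * 1 ^ (m - 1)"
    using nonneg by simp
  then have "gen_diag_dominant m n (diag_single m i v)"
    using gen_diag_dominant_iff_off_row[of m n "diag_single m i v"] nonneg m
    by (metis One_nat_def Suc_1 Suc_leD)
  then show "diag_single m i v \<in> GDD_plus m n" using sym nonneg by (simp add: GDD_plus_def)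
qed

text \<open>
  The classes partition the off-diagonal tuples, \<open>sort\<close> being the map to the class, so they also
  partition each row.
\<close>

lemma sum_class_row:
  assumes m: "m \<ge> 1" and i: "i \<in> {1..n}"
  shows "(\<Sum>\<alpha>\<in>offdiag_indices m n. class_row m n A d \<alpha> i) = off_row m n A d i"
proof -
  let ?J = "index_set (m - 1) n - {replicate (m - 1) i}"
  have mem: "js \<in> ?J \<longleftrightarrow> i # js \<in> off_tuples m n" for js
    using Cons_in_off_tuples[OF m] i by blast
  have "class_row m n A d \<alpha> i = (\<Sum>js | js \<in> ?J \<and> sort (i # js) = \<alpha>. \<bar>A (i # js)\<bar> * monomial d js)"
    if \<alpha>: "\<alpha> \<in> offdiag_indices m n" for \<alpha>
  proof -
    have "mset (i # js) = mset \<alpha> \<Longrightarrow> i # js \<in> off_tuples m n" for js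
      using off_tuples_cong_mset[of "i # js" \<alpha> m n] \<alpha> by (simp add: offdiag_indices_eq)
    then have "{js. js \<in> index_set (m - 1) n \<and> mset (i # js) = mset \<alpha>} =
        {js. js \<in> ?J \<and> sort (i # js) = \<alpha>}"
      using mem mset_eq_iff_sort_eq[OF \<alpha>] by blast
    then show ?thesis by (simp only: class_row_def)
  qed
  then have "(\<Sum>\<alpha>\<in>offdiag_indices m n. class_row m n A d \<alpha> i) =
      (\<Sum>\<alpha>\<in>offdiag_indices m n. \<Sum>js | js \<in> ?J \<and> sort (i # js) = \<alpha>. \<bar>A (i # js)\<bar> * monomial d js)"
    by (intro sum.cong refl)
  also have "\<dots> = off_row m n A d i"
    unfolding off_row_def
    by (rule sum.group) (use mem sort_in_offdiag_indices in \<open>auto simp del: Diff_iff sort_key_simps\<close>)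
  finally show ?thesis .
qed

text \<open>
  Off the diagonal each entry occurs in exactly one class part. On the diagonal the class parts
  together use up \<open>off_row m n A d i / d i ^ (m - 1)\<close>, and the remainder is put into a diagonal tensor.
  If \<open>d\<close> scales \<open>A\<close> to a diagonally dominant tensor with nonnegative diagonal, that remainder is
  nonnegative.
\<close>

lemma class_parts_plus_slack:
  assumes m: "m \<ge> 1" and A: "A \<in> sym_tensors m n" and d: "\<And>i. i \<in> {1..n} \<Longrightarrow> 0 < d i"
  shows "A is = (\<Sum>\<alpha>\<in>offdiag_indices m n. class_part m n A d \<alpha> is) +
    (\<Sum>i\<in>{1..n}. diag_single m i (A (replicate m i) - off_row m n A d i / d i ^ (m - 1)) is)"
    (is "_ = ?P + ?U")
proof -
  consider "is \<notin> index_set m n" | "is \<in> off_tuples m n" | i where "is = replicate m i" "i \<in> {1..n}"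
    using m by (fastforce simp: off_tuples_def index_set_def)
  then show ?thesis
  proof cases
    case 1
    then have "?P = 0" "?U = 0"
      by (auto simp: class_part_def diag_single_def replicate_in_index_set intro!: sum.neutral)
    then show ?thesis using 1 A by (simp add: sym_tensors_def)
  next
    case 2
    have "?P = (\<Sum>\<alpha>\<in>offdiag_indices m n. if sort is = \<alpha> then A is else 0)"
      using 2 by (intro sum.cong refl) (simp add: class_part_off_tuples mset_eq_iff_sort_eq)
    moreover have "?U = 0"
      using 2 by (auto simp: diag_single_def off_tuples_def intro!: sum.neutral)
    ultimately show ?thesis using sort_in_offdiag_indices[OF 2] by simp
  next
    case (3 i)
    have "?P = (\<Sum>\<alpha>\<in>offdiag_indices m n. class_row m n A d \<alpha> i) / d i ^ (m - 1)"
      using 3 class_part_replicate[OF m _ 3(2), of _ A d] by (simp add: sum_divide_distrib)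
    moreover have "?U = (\<Sum>j\<in>{1..n}. if i = j then A (replicate m i) - off_row m n A d i / d i ^ (m - 1) else 0)"
      using 3 m by (intro sum.cong refl) (auto simp: diag_single_def replicate_eq_replicate)
    ultimately show ?thesis
      using 3 sum_class_row[OF m 3(2), of A d] by (simp add: sum.delta del: One_nat_def)
  qed
qed

lemma sum_over_finite_index_as_sequence:
  fixes F :: "'i \<Rightarrow> 'a \<Rightarrow> real"
  assumes "finite I" "I \<noteq> {}" "\<And>i. i \<in> I \<Longrightarrow> F i \<in> X"
  shows "\<exists>(r::nat) B. r \<ge> 1 \<and> (\<forall>k\<in>{1..r}. B k \<in> X) \<and> (\<lambda>a. \<Sum>i\<in>I. F i a) = (\<lambda>a. \<Sum>k=1..r. B k a)"
proof -
  obtain h where h: "bij_betw h {1..card I} I"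
    using ex_bij_betw_nat_finite_1[OF assms(1)] by blast
  have "(\<lambda>a. \<Sum>i\<in>I. F i a) = (\<lambda>a. \<Sum>k=1..card I. F (h k) a)"
    using sum.reindex_bij_betw[OF h, of "\<lambda>i. F i _"] by (intro ext) simp
  moreover have "card I \<ge> 1" using assms by (simp add: Suc_leI card_gt_0_iff)
  moreover have "\<forall>k\<in>{1..card I}. F (h k) \<in> X" using h assms(3) by (auto dest: bij_betwE)
  ultimately show ?thesis by (intro exI[of _ "card I"] exI[of _ "\<lambda>k. F (h k)"]) blast
qed

section \<open>The decomposition theorem\<close>

theorem theorem5:
  fixes m n :: nat and A :: "nat list \<Rightarrow> real"
  assumes "m \<ge> 2" and "n \<ge> 2" and "A \<in> sym_tensors m n"
  shows "A \<in> GDD_plus m n \<longleftrightarrow>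
    (\<exists>(r::nat) (B :: nat \<Rightarrow> nat list \<Rightarrow> real). r \<ge> 1 \<and>
       (\<forall>k\<in>{1..r}. B k \<in> simple_tensors m n \<inter> GDD_plus m n) \<and>
       A = (\<lambda>is. \<Sum>k=1..r. B k is))"
proof
  assume gdd: "A \<in> GDD_plus m n"
  have m1: "m \<ge> 1" using assms(1) by simp
  obtain d where d: "\<And>i. i \<in> {1..n} \<Longrightarrow> 0 < d i"
    and row: "\<And>i. i \<in> {1..n} \<Longrightarrow> off_row m n A d i \<le> A (replicate m i) * d i ^ (m - 1)"
    using gdd gen_diag_dominant_iff_off_row[OF m1, of n A] unfolding GDD_plus_def
    by (smt (verit) mem_Collect_eq)
  define slack where "slack i = A (replicate m i) - off_row m n A d i / d i ^ (m - 1)" for i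
  have slack: "slack i \<ge> 0" if "i \<in> {1..n}" for i
    using row[OF that] d[OF that] by (simp add: slack_def field_simps)
  define I where "I = offdiag_indices m n <+> {1..n}"
  define F where "F = case_sum (class_part m n A d) (\<lambda>i. diag_single m i (slack i))"
  have A_eq: "A = (\<lambda>is. \<Sum>i\<in>I. F i is)"
  proof
    fix "is"
    show "A is = (\<Sum>i\<in>I. F i is)"
      unfolding I_def F_def slack_def
      by (rule trans[OF class_parts_plus_slack[OF m1 assms(3) d]]) (simp_all add: sum.Plus)
  qed
  have "finite I" "I \<noteq> {}" using assms(2) by (auto simp: I_def)
  moreover have "F i \<in> simple_tensors m n \<inter> GDD_plus m n" if "i \<in> I" for i
    using that class_part_in_simple_GDD_plus[OF m1 assms(3) d]
      diag_single_in_simple_GDD_plus[OF assms(1,2) _ slack]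
    unfolding I_def F_def by (elim PlusE) simp_all
  ultimately have "\<exists>(r::nat) B. r \<ge> 1 \<and> (\<forall>k\<in>{1..r}. B k \<in> simple_tensors m n \<inter> GDD_plus m n) \<and>
      (\<lambda>is. \<Sum>i\<in>I. F i is) = (\<lambda>is. \<Sum>k=1..r. B k is)"
    by (rule sum_over_finite_index_as_sequence)
  then show "\<exists>(r::nat) (B :: nat \<Rightarrow> nat list \<Rightarrow> real). r \<ge> 1 \<and>
       (\<forall>k\<in>{1..r}. B k \<in> simple_tensors m n \<inter> GDD_plus m n) \<and> A = (\<lambda>is. \<Sum>k=1..r. B k is)"
    by (simp only: A_eq[symmetric])
next
  assume "\<exists>(r::nat) (B :: nat \<Rightarrow> nat list \<Rightarrow> real). r \<ge> 1 \<and>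
       (\<forall>k\<in>{1..r}. B k \<in> simple_tensors m n \<inter> GDD_plus m n) \<and> A = (\<lambda>is. \<Sum>k=1..r. B k is)"
  then obtain r :: nat and B where B: "\<And>k. k \<in> {1..r} \<Longrightarrow> B k \<in> GDD_plus m n"
    and A: "A = (\<lambda>is. \<Sum>k=1..r. B k is)"
    by (elim exE conjE) (rule that, auto)
  show "A \<in> GDD_plus m n" unfolding A by (rule sum_in_GDD_plus[OF assms(1) B])
qed

end
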